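(* Let $cK = \langle a,b \mid [aba^{-1}b,a] = [b, aba^{-1}b] = 1 \rangle$, with generating set $S=\{a,b\}$. Then $cK$ has no dead end elements with respect to $S$; that is, for every $g \in cK$ there exists $s \in \{a,b,a^{-1},b^{-1}\}$ with $l(gs) > l(g)$.
   Context: For a group $G$ with finite generating set $S$ and $g\in G$, $l(g)$ denotes the length of a shortest word over $S\cup S^{-1}$ representing $g$. An element $g\in G$ is a dead end (with respect to $S$) if $l(gs)\le l(g)$ for all $s\in S\cup S^{-1}$. The commutator is $[x,y]=xyx^{-1}y^{-1}$. *)

theory Defs
  imports "HOL-Algebra.Generated_Groups"
begin

text \<open>The letter \<open>(x, True)\<close> stands for the generator \<open>x\<close>, and \<open>(x, False)\<close> for its formal inverse.\<close>

type_synonym 'g word = "('g \<times> bool) list"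

definition inv_word :: "'g word \<Rightarrow> 'g word"
  where "inv_word w = rev (map (\<lambda>(x, e). (x, \<not> e)) w)"

definition comm_word :: "'g word \<Rightarrow> 'g word \<Rightarrow> 'g word"
  where "comm_word u v = u @ v @ inv_word u @ inv_word v"

text \<open>Two words represent the same element of the group presented by the relators \<open>R\<close> iff one can
  be transformed into the other by inserting and deleting subwords of the form
  \<open>x x\<inverse>\<close>, \<open>x\<inverse> x\<close> or \<open>r \<in> R\<close>.\<close>

inductive pres_eq :: "'g word set \<Rightarrow> 'g word \<Rightarrow> 'g word \<Rightarrow> bool"
  for R :: "'g word set"
  where
    refl: "pres_eq R u u"
  | sym: "pres_eq R u v \<Longrightarrow> pres_eq R v u"
  | trans: "pres_eq R u v \<Longrightarrow> pres_eq R v w \<Longrightarrow> pres_eq R u w"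
  | cancel: "pres_eq R (u @ [(x, e), (x, \<not> e)] @ v) (u @ v)"
  | relator: "r \<in> R \<Longrightarrow> pres_eq R (u @ r @ v) (u @ v)"

definition pres_rel :: "'g word set \<Rightarrow> ('g word \<times> 'g word) set"
  where "pres_rel R = {(u, v). pres_eq R u v}"

definition word_class :: "'g word set \<Rightarrow> 'g word \<Rightarrow> 'g word set"
  where "word_class R w = pres_rel R `` {w}"

text \<open>The set of generators is the whole type \<open>'g\<close>.\<close>

definition presented_group :: "'g word set \<Rightarrow> 'g word set monoid"
  where "presented_group R =
    \<lparr>carrier = UNIV // pres_rel R,
     mult = (\<lambda>X Y. \<Union>u\<in>X. \<Union>v\<in>Y. word_class R (u @ v)),
     one = word_class R []\<rparr>"

definition generator :: "'g word set \<Rightarrow> 'g \<Rightarrow> 'g word set"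
  where "generator R x = word_class R [(x, True)]"

lemma pres_eq_append_left: "pres_eq R u v \<Longrightarrow> pres_eq R (w @ u) (w @ v)"
proof (induction rule: pres_eq.induct)
  case (cancel u x e v)
  then show ?case using pres_eq.cancel[of R "w @ u" x e v] by simp
next
  case (relator r u v)
  then show ?case using pres_eq.relator[of r R "w @ u" v] by simp
qed (blast intro: pres_eq.intros)+

lemma pres_eq_append_right: "pres_eq R u v \<Longrightarrow> pres_eq R (u @ w) (v @ w)"
proof (induction rule: pres_eq.induct)
  case (cancel u x e v)
  then show ?case using pres_eq.cancel[of R u x e "v @ w"] by simp
next
  case (relator r u v)
  then show ?case using pres_eq.relator[of r R u "v @ w"] by simp
qed (blast intro: pres_eq.intros)+

lemma pres_eq_append: "pres_eq R u u' \<Longrightarrow> pres_eq R v v' \<Longrightarrow> pres_eq R (u @ v) (u' @ v')"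
  by (blast intro: pres_eq.trans pres_eq_append_left pres_eq_append_right)

lemma equiv_pres_rel: "equiv UNIV (pres_rel R)"
  unfolding pres_rel_def
  by (intro equivI refl_onI symI transI) (auto intro: pres_eq.intros)

lemma word_class_eq_iff: "word_class R u = word_class R v \<longleftrightarrow> pres_eq R u v"
  using eq_equiv_class_iff[OF equiv_pres_rel, of u v R] by (simp add: word_class_def pres_rel_def)

lemma carrier_presented_group: "carrier (presented_group R) = range (word_class R)"
  by (auto simp: presented_group_def quotient_def word_class_def)

lemma word_class_in_carrier [simp]: "word_class R u \<in> carrier (presented_group R)"
  by (simp add: carrier_presented_group)

lemma one_presented_group: "\<one>\<^bsub>presented_group R\<^esub> = word_class R []"
  by (simp add: presented_group_def)

lemma mult_presented_group:
  "word_class R u \<otimes>\<^bsub>presented_group R\<^esub> word_class R v = word_class R (u @ v)"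
proof -
  have "word_class R (u' @ v') = word_class R (u @ v)"
    if "u' \<in> word_class R u" "v' \<in> word_class R v" for u' v'
  proof -
    have "pres_eq R u u'" "pres_eq R v v'"
      using that by (simp_all add: word_class_def pres_rel_def)
    then show ?thesis
      by (simp add: word_class_eq_iff pres_eq_append pres_eq.sym)
  qed
  moreover have "u \<in> word_class R u" "v \<in> word_class R v"
    by (simp_all add: word_class_def pres_rel_def pres_eq.refl)
  ultimately have "(\<Union>u'\<in>word_class R u. \<Union>v'\<in>word_class R v. word_class R (u' @ v')) = word_class R (u @ v)"
    by blast
  then show ?thesis by (simp add: presented_group_def)
qed

lemma pres_eq_inv_word: "pres_eq R (inv_word w @ w) []"
proof (induction w)
  case Nil
  then show ?case by (simp add: inv_word_def pres_eq.refl)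
next
  case (Cons l w)
  obtain x e where l: "l = (x, e)" by (cases l)
  have "pres_eq R (inv_word (l # w) @ (l # w)) (inv_word w @ w)"
    using pres_eq.cancel[of R "inv_word w" x "\<not> e" w] by (simp add: inv_word_def l)
  then show ?case using Cons.IH by (rule pres_eq.trans)
qed

lemma group_presented_group: "group (presented_group R)"
proof (rule groupI)
  fix X assume "X \<in> carrier (presented_group R)"
  then obtain w where "X = word_class R w" by (auto simp: carrier_presented_group)
  then show "\<exists>Y\<in>carrier (presented_group R). Y \<otimes>\<^bsub>presented_group R\<^esub> X = \<one>\<^bsub>presented_group R\<^esub>"
    by (intro bexI[of _ "word_class R (inv_word w)"])
       (simp_all add: mult_presented_group one_presented_group word_class_eq_iff pres_eq_inv_word)
qed (auto simp: carrier_presented_group mult_presented_group one_presented_group)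

lemma inv_presented_group: "inv\<^bsub>presented_group R\<^esub> (word_class R w) = word_class R (inv_word w)"
  by (rule group.inv_equality[OF group_presented_group])
     (simp_all add: mult_presented_group one_presented_group word_class_eq_iff pres_eq_inv_word)

lemma word_class_relator: "r \<in> R \<Longrightarrow> word_class R r = \<one>\<^bsub>presented_group R\<^esub>"
  using pres_eq.relator[of r R "[]" "[]"] by (simp add: one_presented_group word_class_eq_iff)

lemma generate_presented_group:
  "generate (presented_group R) (range (generator R)) = carrier (presented_group R)" (is "?L = ?C")
proof
  show "?L \<subseteq> ?C"
    by (rule group.generate_incl[OF group_presented_group]) (auto simp: generator_def)
  have "word_class R w \<in> ?L" for w
  proof (induction w)
    case Nil
    then show ?case by (metis generate.one one_presented_group)
  next
    case (Cons l w)
    obtain x e where l: "l = (x, e)" by (cases l)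
    have "word_class R [l] \<in> ?L"
    proof (cases e)
      case True
      then show ?thesis by (auto simp: l generator_def intro!: generate.incl)
    next
      case False
      have "inv\<^bsub>presented_group R\<^esub> (generator R x) \<in> ?L" by (rule generate.inv) simp
      then show ?thesis by (simp add: False l generator_def inv_presented_group inv_word_def)
    qed
    then have "word_class R [l] \<otimes>\<^bsub>presented_group R\<^esub> word_class R w \<in> ?L"
      using Cons.IH by (rule generate.eng)
    then show ?case by (simp add: mult_presented_group)
  qed
  then show "?C \<subseteq> ?L" by (auto simp: carrier_presented_group)
qed

definition sym_gens :: "('a, 'm) monoid_scheme \<Rightarrow> 'a set \<Rightarrow> 'a set"
  where "sym_gens G S = S \<union> m_inv G ` S"

text \<open>Only meaningful if \<open>S\<close> generates \<open>G\<close>: otherwise the set of lengths may be empty.\<close>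

definition word_length :: "('a, 'm) monoid_scheme \<Rightarrow> 'a set \<Rightarrow> 'a \<Rightarrow> nat"
  where "word_length G S g =
    (LEAST n. \<exists>ws. set ws \<subseteq> sym_gens G S \<and> length ws = n \<and> foldr (mult G) ws \<one>\<^bsub>G\<^esub> = g)"

definition dead_end :: "('a, 'm) monoid_scheme \<Rightarrow> 'a set \<Rightarrow> 'a \<Rightarrow> bool"
  where "dead_end G S g \<longleftrightarrow>
    g \<in> carrier G \<and> (\<forall>s\<in>sym_gens G S. word_length G S (g \<otimes>\<^bsub>G\<^esub> s) \<le> word_length G S g)"

datatype gen = Gen_a | Gen_b

definition klein_word :: "gen word"
  where "klein_word = [(Gen_a, True), (Gen_b, True), (Gen_a, False), (Gen_b, True)]"

definition cK_relators :: "gen word set"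
  where "cK_relators = {comm_word klein_word [(Gen_a, True)], comm_word [(Gen_b, True)] klein_word}"

definition cK :: "gen word set monoid"
  where "cK = presented_group cK_relators"

definition cK_a :: "gen word set"
  where "cK_a = generator cK_relators Gen_a"

definition cK_b :: "gen word set"
  where "cK_b = generator cK_relators Gen_b"

lemma group_cK: "group cK"
  by (simp add: cK_def group_presented_group)

lemma generate_cK: "generate cK {cK_a, cK_b} = carrier cK"
proof -
  have UNIV_gen: "(UNIV :: gen set) = {Gen_a, Gen_b}" by (auto intro: gen.exhaust)
  have "range (generator cK_relators) = {cK_a, cK_b}"
    by (simp only: cK_a_def cK_b_def UNIV_gen image_insert image_empty)
  then show ?thesis
    using generate_presented_group[of cK_relators] by (simp add: cK_def)
qed

end

theory Submission
  imports Defs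
begin

text \<open>Put \<open>c = aba\<inverse>\<close>. The relators say exactly that \<open>b\<close> and \<open>c\<close> commute and that conjugation by
  \<open>a\<close> swaps them, so \<open>cK\<close> is \<open>\<int>\<^sup>2 \<rtimes> \<int>\<close> and every element is uniquely \<open>b\<^sup>x c\<^sup>y a\<^sup>n\<close>.
  Its length is \<open>\<bar>x\<bar> + \<bar>y\<bar>\<close> plus the length of a shortest walk on \<open>\<int>\<close> from \<open>0\<close> to \<open>n\<close> which
  visits an odd number if \<open>y \<noteq> 0\<close>. Right multiplication by \<open>b\<^sup>\<plusminus>\<^sup>1\<close> changes \<open>x\<close> if \<open>n\<close> is even
  and \<open>y\<close> if \<open>n\<close> is odd; with the sign chosen to move away from \<open>0\<close> it increases the length.\<close>

text \<open>Conjugation by \<open>z\<close> is a homomorphism, so it carries powers of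
  \<open>y\<close> to powers of \<open>y'\<close>. With \<open>y' = y\<close> this also covers
  commuting elements.\<close>

lemma (in group) int_pow_intertwine:
  fixes k :: int
  assumes "z \<in> carrier G" "y \<in> carrier G" "y' \<in> carrier G" and zy: "z \<otimes> y = y' \<otimes> z"
  shows "z \<otimes> y [^] k = y' [^] k \<otimes> z"
proof -
  have "z \<otimes> y [^] n = y' [^] n \<otimes> z" for n :: nat
  proof (induction n)
    case (Suc n)
    have "z \<otimes> y [^] Suc n = y' [^] n \<otimes> (z \<otimes> y)"
      using assms Suc by (simp add: m_assoc flip: m_assoc[of z])
    then show ?case using assms by (simp add: m_assoc)
  qed (use assms in simp)
  moreover have "z \<otimes> inv u = inv v \<otimes> z"
    if "z \<otimes> u = v \<otimes> z" "u \<in> carrier G" "v \<in> carrier G" for u v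
    using that assms(1) by (metis inv_closed inv_solve_left inv_solve_right m_assoc m_closed)
  ultimately show ?thesis
    using assms by (cases k rule: int_cases2) (simp_all add: int_pow_neg int_pow_int)
qed

section \<open>Word length in presented groups\<close>

lemma sym_gens_presented_group:
  "sym_gens (presented_group R) (range (generator R)) = range (\<lambda>l. word_class R [l])"
proof -
  have "range f = range (\<lambda>x. f (x, True)) \<union> range (\<lambda>x. f (x, False))"
    for f :: "'a \<times> bool \<Rightarrow> 'a word set"
  proof -
    have "(UNIV :: ('a \<times> bool) set) = range (\<lambda>x. (x, True)) \<union> range (\<lambda>x. (x, False))"
      by auto
    then show ?thesis by (metis image_Un image_image)
  qed
  then show ?thesis
    by (simp add: sym_gens_def generator_def image_image inv_presented_group inv_word_def)
qed

lemma foldr_mult_letters: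
  "foldr (mult (presented_group R)) (map (\<lambda>l. word_class R [l]) w) \<one>\<^bsub>presented_group R\<^esub> =
    word_class R w"
  by (induction w) (simp_all add: one_presented_group mult_presented_group)

text \<open>Lists of symmetric generators are exactly the letterwise images of words, so minimising
  over products amounts to minimising over words in one class.\<close>

lemma word_length_presented_group:
  "word_length (presented_group R) (range (generator R)) (word_class R w) =
    (LEAST n. \<exists>v. pres_eq R v w \<and> length v = n)"
proof -
  have "(\<exists>ws. set ws \<subseteq> range (\<lambda>l. word_class R [l]) \<and> length ws = n \<and>
          foldr (mult (presented_group R)) ws \<one>\<^bsub>presented_group R\<^esub> = word_class R w) \<longleftrightarrow>
        (\<exists>v. pres_eq R v w \<and> length v = n)" (is "(\<exists>ws. ?P ws) \<longleftrightarrow> (\<exists>v. ?Q v)") for n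
  proof
    assume "\<exists>ws. ?P ws"
    then obtain ws where ws: "?P ws" by blast
    then have "ws \<in> lists (range (\<lambda>l. word_class R [l]))" by auto
    then obtain v where "ws = map (\<lambda>l. word_class R [l]) v"
      by (auto simp: lists_image)
    with ws show "\<exists>v. ?Q v" by (auto simp: foldr_mult_letters word_class_eq_iff)
  next
    assume "\<exists>v. ?Q v"
    then obtain v where "?Q v" by blast
    then have "?P (map (\<lambda>l. word_class R [l]) v)"
      by (auto simp: foldr_mult_letters word_class_eq_iff)
    then show "\<exists>ws. ?P ws" by blast
  qed
  then show ?thesis by (simp add: word_length_def sym_gens_presented_group)
qed

definition pow_word :: "'g \<Rightarrow> int \<Rightarrow> 'g word"
  where "pow_word x k = replicate (nat \<bar>k\<bar>) (x, k \<ge> 0)"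

lemma length_pow_word [simp]: "length (pow_word x k) = nat \<bar>k\<bar>"
  by (simp add: pow_word_def)

lemma word_class_pow_word:
  "word_class R (pow_word x k) = generator R x [^]\<^bsub>presented_group R\<^esub> k"
proof -
  interpret group "presented_group R" by (rule group_presented_group)
  have *: "word_class R (replicate n l) = word_class R [l] [^]\<^bsub>presented_group R\<^esub> n" for n l
  proof (induction n)
    case (Suc n)
    have "word_class R (replicate (Suc n) l) = word_class R (replicate n l @ [l])"
      by (simp add: replicate_append_same)
    then show ?case using Suc by (simp flip: mult_presented_group)
  qed (simp add: one_presented_group)
  have "word_class R [(x, False)] = inv\<^bsub>presented_group R\<^esub> generator R x"
    by (simp add: generator_def inv_presented_group inv_word_def)
  then show ?thesis
    by (cases k rule: int_cases3)
       (simp_all add: pow_word_def * generator_def int_pow_neg int_pow_int nat_pow_inv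
          one_presented_group)
qed

section \<open>Action on coordinates and the lower bound\<close>

text \<open>The triple \<open>(x, y, n)\<close> encodes \<open>b\<^sup>x c\<^sup>y a\<^sup>n\<close>, and letters act by left multiplication.\<close>

fun letter_act :: "gen \<times> bool \<Rightarrow> int \<times> int \<times> int \<Rightarrow> int \<times> int \<times> int"
  where
    "letter_act (Gen_a, e) (x, y, n) = (y, x, if e then n + 1 else n - 1)"
  | "letter_act (Gen_b, e) (x, y, n) = (if e then x + 1 else x - 1, y, n)"

definition coords :: "gen word \<Rightarrow> int \<times> int \<times> int"
  where "coords w = foldr letter_act w (0, 0, 0)"

text \<open>Opposite letters act as mutually inverse maps. \<open>klein_word\<close> acts as the
  translation by \<open>(1, 1, 0)\<close>, which commutes with the actions of both generators, so
  the relators act trivially. Equality of whole functions is what survives putting words in a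
  context.\<close>

lemma foldr_letter_act_cong:
  "pres_eq cK_relators u v \<Longrightarrow> foldr letter_act u = foldr letter_act v"
proof (induction rule: pres_eq.induct)
  case (cancel u x e v)
  have "letter_act (x, e) (letter_act (x, \<not> e) p) = p" for p
    by (cases x; cases p) auto
  then show ?case by (simp add: fun_eq_iff)
next
  case (relator r u v)
  then have "foldr letter_act r p = p" for p
    by (cases p) (auto simp: cK_relators_def comm_word_def inv_word_def klein_word_def)
  then show ?case by (simp add: fun_eq_iff)
qed simp_all

lemma coords_cong: "pres_eq cK_relators u v \<Longrightarrow> coords u = coords v"
  by (simp add: coords_def foldr_letter_act_cong)

text \<open>The conditional is the length of the walk: a direct walk to \<open>n \<noteq> 0\<close>
  already passes 1 or -1, so only \<open>n = 0\<close> with \<open>y \<noteq> 0\<close> costs a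
  detour of two steps.\<close>

fun coords_length :: "int \<times> int \<times> int \<Rightarrow> nat"
  where "coords_length (x, y, n) =
    nat (\<bar>x\<bar> + \<bar>y\<bar> + (if n = 0 \<and> y \<noteq> 0 then 2 else \<bar>n\<bar>))"

text \<open>A letter for \<open>a\<close> preserves \<open>\<bar>x\<bar> + \<bar>y\<bar>\<close>.
  The detour can appear only on reaching \<open>n = 0\<close> from 1 or -1, where the walk term
  rises from 1 to 2.\<close>

lemma coords_length_letter_act: "coords_length (letter_act l p) \<le> Suc (coords_length p)"
  by (cases "(l, p)" rule: letter_act.cases) auto

lemma coords_length_le: "coords_length (coords w) \<le> length w"
proof (induction w)
  case (Cons l w)
  then show ?case
    using coords_length_letter_act[of l "coords w"] by (simp add: coords_def)
qed (simp add: coords_def)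

section \<open>Relations between \<open>a\<close>, \<open>b\<close> and \<open>c\<close>\<close>

lemma word_class_append_cK:
  "word_class cK_relators (u @ v) = word_class cK_relators u \<otimes>\<^bsub>cK\<^esub> word_class cK_relators v"
  by (simp add: cK_def mult_presented_group)

definition cK_c :: "gen word set"
  where "cK_c = cK_a \<otimes>\<^bsub>cK\<^esub> cK_b \<otimes>\<^bsub>cK\<^esub> inv\<^bsub>cK\<^esub> cK_a"

lemma cK_closed [simp]:
  "cK_a \<in> carrier cK" "cK_b \<in> carrier cK" "cK_c \<in> carrier cK"
proof -
  show ab: "cK_a \<in> carrier cK" "cK_b \<in> carrier cK"
    by (simp_all add: cK_a_def cK_b_def cK_def generator_def)
  interpret group cK by (rule group_cK)
  show "cK_c \<in> carrier cK" using ab by (simp add: cK_c_def)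
qed

lemma cK_a_b: "cK_a \<otimes>\<^bsub>cK\<^esub> cK_b = cK_c \<otimes>\<^bsub>cK\<^esub> cK_a"
proof -
  interpret group cK by (rule group_cK)
  show ?thesis by (simp add: cK_c_def m_assoc)
qed

lemma word_class_commute:
  assumes "comm_word u v \<in> R"
  shows "word_class R (u @ v) = word_class R (v @ u)"
proof -
  interpret group "presented_group R" by (rule group_presented_group)
  have "inv_word (v @ u) = inv_word u @ inv_word v" by (simp add: inv_word_def)
  then have "word_class R u \<otimes>\<^bsub>presented_group R\<^esub> word_class R v \<otimes>\<^bsub>presented_group R\<^esub>
      inv\<^bsub>presented_group R\<^esub> (word_class R v \<otimes>\<^bsub>presented_group R\<^esub> word_class R u) =
      \<one>\<^bsub>presented_group R\<^esub>"
    using word_class_relator[OF assms]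
    by (simp add: comm_word_def inv_presented_group mult_presented_group)
  from inv_solve_right[THEN iffD1, OF _ _ _ this[symmetric]] show ?thesis
    by (simp add: mult_presented_group)
qed

lemma cK_klein: "word_class cK_relators klein_word = cK_c \<otimes>\<^bsub>cK\<^esub> cK_b"
  by (simp add: klein_word_def cK_c_def cK_a_def cK_b_def cK_def generator_def
      inv_presented_group inv_word_def mult_presented_group)

text \<open>The Klein word is \<open>cb\<close>, so the second relator gives
  \<open>bcb = cbb\<close>; cancel \<open>b\<close> on the right.\<close>

lemma cK_b_c: "cK_b \<otimes>\<^bsub>cK\<^esub> cK_c = cK_c \<otimes>\<^bsub>cK\<^esub> cK_b"
proof -
  interpret group cK by (rule group_cK)
  have "word_class cK_relators ([(Gen_b, True)] @ klein_word) =
        word_class cK_relators (klein_word @ [(Gen_b, True)])"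
    by (rule word_class_commute) (simp add: cK_relators_def)
  then have "cK_b \<otimes>\<^bsub>cK\<^esub> (cK_c \<otimes>\<^bsub>cK\<^esub> cK_b) = cK_c \<otimes>\<^bsub>cK\<^esub> cK_b \<otimes>\<^bsub>cK\<^esub> cK_b"
    by (simp only: word_class_append_cK cK_klein flip: generator_def cK_b_def)
  then show ?thesis by (simp flip: m_assoc)
qed

text \<open>The first relator gives \<open>cba = acb = abc = cac\<close>; cancel \<open>c\<close> on
  the left.\<close>

lemma cK_a_c: "cK_a \<otimes>\<^bsub>cK\<^esub> cK_c = cK_b \<otimes>\<^bsub>cK\<^esub> cK_a"
proof -
  interpret group cK by (rule group_cK)
  have "word_class cK_relators (klein_word @ [(Gen_a, True)]) =
        word_class cK_relators ([(Gen_a, True)] @ klein_word)"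
    by (rule word_class_commute) (simp add: cK_relators_def)
  then have "cK_c \<otimes>\<^bsub>cK\<^esub> cK_b \<otimes>\<^bsub>cK\<^esub> cK_a = cK_a \<otimes>\<^bsub>cK\<^esub> (cK_c \<otimes>\<^bsub>cK\<^esub> cK_b)"
    by (simp only: word_class_append_cK cK_klein flip: generator_def cK_a_def)
  also have "\<dots> = cK_a \<otimes>\<^bsub>cK\<^esub> cK_b \<otimes>\<^bsub>cK\<^esub> cK_c"
    by (simp add: m_assoc flip: cK_b_c)
  also have "\<dots> = cK_c \<otimes>\<^bsub>cK\<^esub> (cK_a \<otimes>\<^bsub>cK\<^esub> cK_c)"
    by (simp add: cK_a_b m_assoc)
  finally show ?thesis by (simp add: m_assoc)
qed

section \<open>Normal forms and shortest words\<close>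

fun cK_elem :: "int \<times> int \<times> int \<Rightarrow> gen word set"
  where "cK_elem (x, y, n) =
    cK_b [^]\<^bsub>cK\<^esub> x \<otimes>\<^bsub>cK\<^esub> cK_c [^]\<^bsub>cK\<^esub> y \<otimes>\<^bsub>cK\<^esub> cK_a [^]\<^bsub>cK\<^esub> n"

lemma cK_a_elem: "cK_a \<otimes>\<^bsub>cK\<^esub> cK_elem (x, y, n) = cK_elem (y, x, n + 1)"
proof -
  interpret group cK by (rule group_cK)
  have "cK_a \<otimes>\<^bsub>cK\<^esub> cK_elem (x, y, n) =
      (cK_a \<otimes>\<^bsub>cK\<^esub> cK_b [^]\<^bsub>cK\<^esub> x) \<otimes>\<^bsub>cK\<^esub> cK_c [^]\<^bsub>cK\<^esub> y \<otimes>\<^bsub>cK\<^esub> cK_a [^]\<^bsub>cK\<^esub> n"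
    by (simp add: m_assoc)
  also have "\<dots> = cK_c [^]\<^bsub>cK\<^esub> x \<otimes>\<^bsub>cK\<^esub> (cK_a \<otimes>\<^bsub>cK\<^esub> cK_c [^]\<^bsub>cK\<^esub> y) \<otimes>\<^bsub>cK\<^esub> cK_a [^]\<^bsub>cK\<^esub> n"
    by (simp add: int_pow_intertwine[OF _ _ _ cK_a_b] m_assoc)
  also have "\<dots> = (cK_c [^]\<^bsub>cK\<^esub> x \<otimes>\<^bsub>cK\<^esub> cK_b [^]\<^bsub>cK\<^esub> y) \<otimes>\<^bsub>cK\<^esub> (cK_a \<otimes>\<^bsub>cK\<^esub> cK_a [^]\<^bsub>cK\<^esub> n)"
    by (simp add: int_pow_intertwine[OF _ _ _ cK_a_c] m_assoc)
  \<comment> \<open>The intertwining rule is used once per exponent: first with \<open>z\<close> the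
    power of \<open>c\<close>, which leaves \<open>b\<close> to be commuted past that power.\<close>
  also have "cK_c [^]\<^bsub>cK\<^esub> x \<otimes>\<^bsub>cK\<^esub> cK_b [^]\<^bsub>cK\<^esub> y = cK_b [^]\<^bsub>cK\<^esub> y \<otimes>\<^bsub>cK\<^esub> cK_c [^]\<^bsub>cK\<^esub> x"
    by (rule int_pow_intertwine) (simp_all add: int_pow_intertwine[OF _ _ _ cK_b_c])
  also have "cK_a \<otimes>\<^bsub>cK\<^esub> cK_a [^]\<^bsub>cK\<^esub> n = cK_a [^]\<^bsub>cK\<^esub> (n + 1)"
    by (simp add: int_pow_mult int_pow_intertwine)
  finally show ?thesis by simp
qed

lemma cK_b_elem: "cK_b \<otimes>\<^bsub>cK\<^esub> cK_elem (x, y, n) = cK_elem (x + 1, y, n)"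
proof -
  interpret group cK by (rule group_cK)
  have "cK_b \<otimes>\<^bsub>cK\<^esub> cK_b [^]\<^bsub>cK\<^esub> x = cK_b [^]\<^bsub>cK\<^esub> (x + 1)"
    by (simp add: int_pow_mult int_pow_intertwine)
  then show ?thesis by (simp flip: m_assoc)
qed

lemma cK_elem_closed [simp]: "cK_elem p \<in> carrier cK"
proof -
  interpret group cK by (rule group_cK)
  show ?thesis by (cases p) simp
qed

text \<open>Only positive letters need the relations. An inverse letter follows because its action
  is undone by that of the positive letter.\<close>

lemma word_class_letter_mult_elem:
  "word_class cK_relators [l] \<otimes>\<^bsub>cK\<^esub> cK_elem p = cK_elem (letter_act l p)"
proof -
  interpret group cK by (rule group_cK)
  have pos: "word_class cK_relators [(g, True)] \<otimes>\<^bsub>cK\<^esub> cK_elem q = cK_elem (letter_act (g, True) q)"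
    for g q
    using cK_a_elem cK_b_elem
    by (cases "((g, True), q)" rule: letter_act.cases) (simp_all add: cK_a_def cK_b_def generator_def del: cK_elem.simps)
  obtain g e where l: "l = (g, e)" by (cases l)
  show ?thesis
  proof (cases e)
    case True
    then show ?thesis by (simp add: l pos)
  next
    case False
    have "letter_act (g, True) (letter_act (g, False) p) = p"
      by (cases g; cases p) auto
    then have "word_class cK_relators [(g, True)] \<otimes>\<^bsub>cK\<^esub> cK_elem (letter_act l p) = cK_elem p"
      by (simp add: l False pos)
    moreover have "word_class cK_relators [l] = inv\<^bsub>cK\<^esub> (word_class cK_relators [(g, True)])"
      by (simp add: l False cK_def inv_presented_group inv_word_def)
    moreover have "word_class cK_relators [(g, True)] \<in> carrier cK" by (simp add: cK_def)
    ultimately show ?thesis by (metis cK_elem_closed inv_solve_left)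
  qed
qed

text \<open>This gives existence of the normal form; its uniqueness comes from
  \<open>coords_cong\<close>.\<close>

lemma word_class_eq_cK_elem: "word_class cK_relators w = cK_elem (coords w)"
proof (induction w)
  case Nil
  interpret group cK by (rule group_cK)
  show ?case by (simp add: coords_def) (simp add: cK_def one_presented_group)
next
  case (Cons l w)
  have "word_class cK_relators (l # w) = word_class cK_relators [l] \<otimes>\<^bsub>cK\<^esub> word_class cK_relators w"
    using word_class_append_cK[of "[l]" w] by simp
  then show ?case by (simp add: Cons word_class_letter_mult_elem coords_def)
qed

text \<open>Both \<open>a\<close> and its inverse conjugate \<open>b\<close> to \<open>c\<close>, so
  the block for \<open>c\<close> can be written at position 1 or -1. Choosing the side of
  \<open>n\<close> keeps the walk direct; for \<open>n = 0\<close> the detour goes through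
  1.\<close>

fun normal_word :: "int \<times> int \<times> int \<Rightarrow> gen word"
  where "normal_word (x, y, n) = pow_word Gen_b x @
    (if y = 0 then pow_word Gen_a n
     else if n < 0 then pow_word Gen_a (-1) @ pow_word Gen_b y @ pow_word Gen_a (n + 1)
     else pow_word Gen_a 1 @ pow_word Gen_b y @ pow_word Gen_a (n - 1))"

lemma length_normal_word: "length (normal_word p) = coords_length p"
  by (cases p) auto

lemma word_class_normal_word: "word_class cK_relators (normal_word p) = cK_elem p"
proof -
  interpret group cK by (rule group_cK)
  obtain x y n where p: "p = (x, y, n)" by (cases p)
  have pw: "word_class cK_relators (pow_word Gen_a k) = cK_a [^]\<^bsub>cK\<^esub> k"
    "word_class cK_relators (pow_word Gen_b k) = cK_b [^]\<^bsub>cK\<^esub> k" for k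
    by (simp_all add: word_class_pow_word cK_def cK_a_def cK_b_def)
  \<comment> \<open>Solve \<open>ac = ba\<close> for the inverse of \<open>a\<close>: its
    conjugation swaps \<open>b\<close> and \<open>c\<close> too.\<close>
  have "inv\<^bsub>cK\<^esub> cK_a \<otimes>\<^bsub>cK\<^esub> cK_b = cK_c \<otimes>\<^bsub>cK\<^esub> inv\<^bsub>cK\<^esub> cK_a"
    using cK_a_c by (metis cK_closed inv_closed inv_solve_left inv_solve_right m_assoc m_closed)
  then have conj: "cK_a [^]\<^bsub>cK\<^esub> e \<otimes>\<^bsub>cK\<^esub> cK_b [^]\<^bsub>cK\<^esub> y = cK_c [^]\<^bsub>cK\<^esub> y \<otimes>\<^bsub>cK\<^esub> cK_a [^]\<^bsub>cK\<^esub> e"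
    if "e = 1 \<or> e = -1" for e :: int
    using that by (intro int_pow_intertwine) (auto simp: int_pow_neg cK_a_b)
  have "cK_a [^]\<^bsub>cK\<^esub> e \<otimes>\<^bsub>cK\<^esub> (cK_b [^]\<^bsub>cK\<^esub> y \<otimes>\<^bsub>cK\<^esub> cK_a [^]\<^bsub>cK\<^esub> (n - e)) =
      cK_c [^]\<^bsub>cK\<^esub> y \<otimes>\<^bsub>cK\<^esub> cK_a [^]\<^bsub>cK\<^esub> n" if e: "e = 1 \<or> e = -1" for e :: int
  proof -
    have "cK_a [^]\<^bsub>cK\<^esub> e \<otimes>\<^bsub>cK\<^esub> (cK_b [^]\<^bsub>cK\<^esub> y \<otimes>\<^bsub>cK\<^esub> cK_a [^]\<^bsub>cK\<^esub> (n - e)) =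
        cK_c [^]\<^bsub>cK\<^esub> y \<otimes>\<^bsub>cK\<^esub> (cK_a [^]\<^bsub>cK\<^esub> e \<otimes>\<^bsub>cK\<^esub> cK_a [^]\<^bsub>cK\<^esub> (n - e))"
      by (simp add: conj[OF e] flip: m_assoc)
    then show ?thesis by (simp flip: int_pow_mult)
  qed
  \<comment> \<open>The two values of \<open>e\<close> serve the branches \<open>n \<ge> 0\<close>
    and \<open>n < 0\<close> of \<open>normal_word\<close>.\<close>
  from this[of 1] this[of "-1"] show ?thesis
    by (simp add: p word_class_append_cK pw m_assoc del: int_pow_1)
qed

text \<open>The normal word attains the bound, and by invariance of \<open>coords\<close> no
  equivalent word is shorter.\<close>

lemma word_length_cK:
  "word_length cK {cK_a, cK_b} (word_class cK_relators w) = coords_length (coords w)"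
proof -
  have UNIV_gen: "(UNIV :: gen set) = {Gen_a, Gen_b}" by (auto intro: gen.exhaust)
  have gens: "{cK_a, cK_b} = range (generator cK_relators)"
    by (simp only: cK_a_def cK_b_def UNIV_gen image_insert image_empty)
  have "(LEAST n. \<exists>v. pres_eq cK_relators v w \<and> length v = n) = coords_length (coords w)"
  proof (rule Least_equality)
    have "pres_eq cK_relators (normal_word (coords w)) w"
      unfolding word_class_eq_iff[symmetric]
      by (simp only: word_class_normal_word word_class_eq_cK_elem[of w])
    then show "\<exists>v. pres_eq cK_relators v w \<and> length v = coords_length (coords w)"
      using length_normal_word by blast
  next
    fix n assume "\<exists>v. pres_eq cK_relators v w \<and> length v = n"
    then show "coords_length (coords w) \<le> n"
      using coords_length_le coords_cong by metis
  qed
  then show ?thesis by (simp add: gens cK_def word_length_presented_group)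
qed

section \<open>Right multiplication by \<open>b\<close>\<close>

text \<open>The appended letter acts first; each later letter for \<open>a\<close> swaps the two
  coordinates, and the number of swaps has the parity of \<open>n\<close>.\<close>

lemma coords_snoc_b:
  assumes "coords w = (x, y, n)"
  shows "coords (w @ [(Gen_b, e)]) =
    (if even n then (x + (if e then 1 else -1), y, n) else (x, y + (if e then 1 else -1), n))"
  using assms
proof (induction w arbitrary: x y n)
  case (Cons l w)
  obtain x' y' n' where w: "coords w = (x', y', n')" by (cases "coords w")
  have "coords (l # v) = letter_act l (coords v)" for v by (simp add: coords_def)
  with Cons.prems Cons.IH[OF w] w show ?case
    by (cases l; cases "fst l") (auto split: if_splits)
qed (auto simp: coords_def)

theorem theorem1:
  "(\<forall>g\<in>carrier cK. \<not> dead_end cK {cK_a, cK_b} g) \<and>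
   (\<forall>g\<in>carrier cK. \<exists>s\<in>{cK_a, cK_b, inv\<^bsub>cK\<^esub> cK_a, inv\<^bsub>cK\<^esub> cK_b}.
      word_length cK {cK_a, cK_b} (g \<otimes>\<^bsub>cK\<^esub> s) > word_length cK {cK_a, cK_b} g)"
proof -
  have longer: "\<exists>s\<in>{cK_b, inv\<^bsub>cK\<^esub> cK_b}.
      word_length cK {cK_a, cK_b} (g \<otimes>\<^bsub>cK\<^esub> s) > word_length cK {cK_a, cK_b} g"
    if "g \<in> carrier cK" for g
  proof -
    from that obtain w where g: "g = word_class cK_relators w"
      by (auto simp: cK_def carrier_presented_group)
    obtain x y n where w: "coords w = (x, y, n)" by (cases "coords w")
    \<comment> \<open>The sign moves the affected coordinate away from 0. The walk term is
      unchanged: \<open>y\<close> changes only for odd \<open>n\<close>, and then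
      \<open>n \<noteq> 0\<close>.\<close>
    define e where "e \<longleftrightarrow> (if even n then x else y) \<ge> 0"
    define s where "s = word_class cK_relators [(Gen_b, e)]"
    have "s \<in> {cK_b, inv\<^bsub>cK\<^esub> cK_b}"
      by (cases e) (simp_all add: s_def cK_b_def cK_def generator_def inv_presented_group inv_word_def)
    moreover have "g \<otimes>\<^bsub>cK\<^esub> s = word_class cK_relators (w @ [(Gen_b, e)])"
      by (simp add: g s_def word_class_append_cK)
    then have "word_length cK {cK_a, cK_b} (g \<otimes>\<^bsub>cK\<^esub> s) > word_length cK {cK_a, cK_b} g"
      by (auto simp: g word_length_cK coords_snoc_b[OF w] w e_def)
    ultimately show ?thesis by blast
  qed
  have "\<not> dead_end cK {cK_a, cK_b} g" if "g \<in> carrier cK" for g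
    using longer[OF that] by (auto simp: dead_end_def sym_gens_def not_le)
  with longer show ?thesis by blast
qed

end
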